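(* A flat disunification problem $\Gamma$ has a local solution iff the propositional clause set $\mathsf{Cl}(\Gamma)$ is satisfiable.
   Context: $\mathcal{EL}$ concept terms are built from concept names and role names using $C\sqcap D$, $\exists r.C$ and $\top$; $C\sqsubseteq D$ means $C^{\mathcal I}\subseteq D^{\mathcal I}$ in every interpretation. Concept names are split into variables $N_v$ and constants $N_c$. $\Gamma$ is a flat disunification problem: subsumptions $C_1\sqcap\dots\sqcap C_n\sqsubseteq^? D$ of flat atoms (concept names or $\exists r.A$, $A$ a concept name) and dissubsumptions, all of the form $X\not\sqsubseteq^? Y$ with variables $X,Y$ (w.l.o.g.); $N_v,N_c,N_R$ are exactly the variables, constants and roles occurring in $\Gamma$. A solution is a substitution of ground terms for variables with $\sigma(C)\sqsubseteq\sigma(D)$ for each subsumption and $\sigma(X)\not\sqsubseteq\sigma(Y)$ for each dissubsumption. $\mathsf{At}$ = atoms occurring as subterms of $\Gamma$, $\mathsf{At_{nv}}=\mathsf{At}\setminus N_v$. A local solution is a solution of the form $\sigma_S$ where $S$ assigns each variable $X$ a set $S_X\subseteq\mathsf{At_{nv}}$, the transitive closure of "$Y$ occurs in an atom of $S_X$" is irreflexive, and $\sigma_S(X):=\sigma_S(D_1)\sqcap\dots\sqcap\sigma_S(D_k)$ for $S_X=\{D_1,\dots,D_k\}$ ($\top$ if empty). $\mathsf{Cl}(\Gamma)$ is the clause set over propositional variables $[C\sqsubseteq D]$ ($C,D\in\mathsf{At}$), $[X>Y]$ ($X,Y\in N_v$), $p_{C,X,D}$ ($C\in\mathsf{At}$,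 $X\in N_v$, $D\in\mathsf{At_{nv}}$): (Ia) for each $C_1\sqcap\dots\sqcap C_n\sqsubseteq^? D$ in $\Gamma$ with $D\in\mathsf{At_{nv}}$: $[C_1\sqsubseteq D]\lor\dots\lor[C_n\sqsubseteq D]$; (Ib) for each $C_1\sqcap\dots\sqcap C_n\sqsubseteq^? X$ in $\Gamma$, $X\in N_v$, and $E\in\mathsf{At_{nv}}$: $[X\sqsubseteq E]\to[C_1\sqsubseteq E]\lor\dots\lor[C_n\sqsubseteq E]$; (Ic) for each $X\not\sqsubseteq^? Y$ in $\Gamma$: $\lnot[X\sqsubseteq Y]$; (IIa) $[A\sqsubseteq A]$ for $A\in N_c$; (IIb) $\lnot[A\sqsubseteq B]$ for distinct $A,B\in N_c$; (IIc) $\lnot[\exists r.A\sqsubseteq\exists s.B]$ for $\exists r.A,\exists s.B\in\mathsf{At_{nv}}$, $r\ne s$; (IId) $\lnot[A\sqsubseteq\exists r.B]$ and $\lnot[\exists r.B\sqsubseteq A]$ for $A\in N_c$, $\exists r.B\in\mathsf{At_{nv}}$; (IIe) $[\exists r.A\sqsubseteq\exists r.B]\to[A\sqsubseteq B]$ and $[A\sqsubseteq B]\to[\exists r.A\sqsubseteq\exists r.B]$; (III) $[C_1\sqsubseteq C_2]\land[C_2\sqsubseteq C_3]\to[C_1\sqsubseteq C_3]$ for $C_1,C_2,C_3\in\mathsf{At}$; (IV) for $C\in\mathsf{At}$, $X\in N_v$: $[C\sqsubseteq X]\lor\bigvee_{D\in\mathsf{At_{nv}}}p_{C,X,D}$,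 and for each $D\in\mathsf{At_{nv}}$: $p_{C,X,D}\to[X\sqsubseteq D]$ and $\lnot(p_{C,X,D}\land[C\sqsubseteq D])$; (Va) $\lnot[X>X]$; (Vb) $[X>Y]\land[Y>Z]\to[X>Z]$; (Vc) $[X\sqsubseteq\exists r.Y]\to[X>Y]$ for $X,Y\in N_v$ with $\exists r.Y\in\mathsf{At}$. *)

theory Defs
  imports Main
begin

text \<open>The split of the concept names into variables and constants is built into the type.\<close>

datatype (vars: 'v, constants: 'c, roles: 'r) concept =
    Top
  | Var 'v
  | Const 'c
  | Conj "('v, 'c, 'r) concept" "('v, 'c, 'r) concept"
  | Exists 'r "('v, 'c, 'r) concept"

record ('v, 'c, 'r, 'd) interp =
  carr :: "'d set"
  ivar :: "'v \<Rightarrow> 'd set"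
  iconst :: "'c \<Rightarrow> 'd set"
  irole :: "'r \<Rightarrow> ('d \<times> 'd) set"

definition is_interp :: "('v, 'c, 'r, 'd) interp \<Rightarrow> bool" where
  "is_interp I \<longleftrightarrow> carr I \<noteq> {} \<and> (\<forall>X. ivar I X \<subseteq> carr I) \<and> (\<forall>A. iconst I A \<subseteq> carr I) \<and>
     (\<forall>r. irole I r \<subseteq> carr I \<times> carr I)"

primrec ext :: "('v, 'c, 'r, 'd) interp \<Rightarrow> ('v, 'c, 'r) concept \<Rightarrow> 'd set" where
  "ext I Top = carr I"
| "ext I (Var X) = ivar I X"
| "ext I (Const A) = iconst I A"
| "ext I (Conj C D) = ext I C \<inter> ext I D"
| "ext I (Exists r C) = {x \<in> carr I. \<exists>y. (x, y) \<in> irole I r \<and> y \<in> ext I C}"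

text \<open>A definition cannot quantify over all domain types, so the domain ranges over the nonempty
  sets of natural numbers. The lemma \<open>subsumed_iff\<close> below shows that nothing is lost.\<close>

definition subsumed :: "('v, 'c, 'r) concept \<Rightarrow> ('v, 'c, 'r) concept \<Rightarrow> bool"
    (infix "\<sqsubseteq>" 50) where
  "C \<sqsubseteq> D \<longleftrightarrow> (\<forall>I :: ('v, 'c, 'r, nat) interp. is_interp I \<longrightarrow> ext I C \<subseteq> ext I D)"

definition restr :: "('v, 'c, 'r, 'd) interp \<Rightarrow> 'd set \<Rightarrow> ('v, 'c, 'r, 'd) interp" where
  "restr I A = \<lparr>carr = A, ivar = (\<lambda>X. ivar I X \<inter> A), iconst = (\<lambda>B. iconst I B \<inter> A),
     irole = (\<lambda>r. irole I r \<inter> A \<times> A)\<rparr>"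

definition transp :: "('d \<Rightarrow> 'e) \<Rightarrow> ('v, 'c, 'r, 'd) interp \<Rightarrow> ('v, 'c, 'r, 'e) interp" where
  "transp f I = \<lparr>carr = f ` carr I, ivar = (\<lambda>X. f ` ivar I X), iconst = (\<lambda>B. f ` iconst I B),
     irole = (\<lambda>r. map_prod f f ` irole I r)\<rparr>"

lemma ext_carr: "is_interp I \<Longrightarrow> ext I C \<subseteq> carr I"
  by (induction C) (auto simp: is_interp_def)

lemma is_interp_restr: "A \<noteq> {} \<Longrightarrow> is_interp (restr I A)"
  by (auto simp: is_interp_def restr_def)

lemma ext_restr_mono: "A \<subseteq> B \<Longrightarrow> ext (restr I A) C \<subseteq> ext (restr I B) C"
  by (induction C) (auto simp: restr_def)

lemma ext_restr_subset:
  assumes "A \<subseteq> carr I"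
  shows "ext (restr I A) C \<subseteq> ext I C"
  using assms by (induction C) (auto simp: restr_def)

lemma ext_finite_witness:
  assumes "is_interp I" "x \<in> ext I C"
  shows "\<exists>A. finite A \<and> A \<subseteq> carr I \<and> x \<in> ext (restr I A) C"
  using assms(2)
proof (induction C arbitrary: x)
  case Top
  then show ?case by (intro exI[of _ "{x}"]) (auto simp: restr_def)
next
  case (Var X)
  then show ?case using assms(1)
    by (intro exI[of _ "{x}"]) (auto simp: restr_def is_interp_def)
next
  case (Const B)
  then show ?case using assms(1)
    by (intro exI[of _ "{x}"]) (auto simp: restr_def is_interp_def)
next
  case (Conj C D)
  then obtain A B where "finite A" "A \<subseteq> carr I" "x \<in> ext (restr I A) C"
    "finite B" "B \<subseteq> carr I" "x \<in> ext (restr I B) D" by (metis IntE ext.simps(4))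
  then show ?case
    using ext_restr_mono[of A "A \<union> B" I C] ext_restr_mono[of B "A \<union> B" I D]
    by (intro exI[of _ "A \<union> B"]) auto
next
  case (Exists r C)
  then obtain y where y: "(x, y) \<in> irole I r" "y \<in> ext I C" "x \<in> carr I" by auto
  with Exists.IH obtain A where A: "finite A" "A \<subseteq> carr I" "y \<in> ext (restr I A) C" by blast
  have "y \<in> carr I" using y ext_carr[OF assms(1)] by blast
  moreover have "y \<in> ext (restr I (insert x (insert y A))) C"
    using A(3) ext_restr_mono[of A "insert x (insert y A)" I C] by blast
  ultimately show ?case using A y
    by (intro exI[of _ "insert x (insert y A)"]) (auto simp: restr_def)
qed

lemma ext_transp:
  assumes "is_interp I" "inj_on f (carr I)"
  shows "ext (transp f I) C = f ` ext I C"
proof (induction C)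
  case (Conj C D)
  then show ?case using inj_on_image_Int[OF assms(2) ext_carr ext_carr] assms(1) by auto
next
  case (Exists r C)
  have *: "a = b" if "f a = f b" "a \<in> carr I" "b \<in> carr I" for a b
    using assms(2) that by (auto dest: inj_onD)
  have r: "a \<in> carr I \<and> b \<in> carr I" if "(a, b) \<in> irole I r" for a b
    using assms(1) that by (auto simp: is_interp_def)
  have c: "a \<in> carr I" if "a \<in> ext I C" for a
    using ext_carr[OF assms(1)] that by blast
  have "z \<in> f ` ext I (Exists r C)" if "z \<in> ext (transp f I) (Exists r C)" for z
  proof -
    from that obtain w where "(z, w) \<in> irole (transp f I) r" "w \<in> f ` ext I C"
      by (auto simp: Exists.IH)
    moreover from this obtain a b where ab: "(a, b) \<in> irole I r" "z = f a" "w = f b"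
      by (auto simp: transp_def)
    ultimately obtain e where e: "f b = f e" "e \<in> ext I C" by auto
    have "b = e" using *[OF e(1)] r[OF ab(1)] c[OF e(2)] by blast
    then have "a \<in> ext I (Exists r C)" using ab(1) e(2) r[OF ab(1)] by auto
    then show ?thesis using ab(2) by blast
  qed
  moreover have "f x \<in> ext (transp f I) (Exists r C)" if "x \<in> ext I (Exists r C)" for x
  proof -
    from that obtain y where "x \<in> carr I" "(x, y) \<in> irole I r" "y \<in> ext I C" by auto
    then have "f x \<in> carr (transp f I)" "(f x, f y) \<in> irole (transp f I) r"
        "f y \<in> ext (transp f I) C"
      using Exists.IH by (auto simp: transp_def intro: image_eqI[where x = "(x, y)"])
    then show ?thesis by auto
  qed
  ultimately show ?case by blast
qed (auto simp: transp_def)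

lemma is_interp_transp: "is_interp I \<Longrightarrow> is_interp (transp f I)"
proof -
  have "map_prod f f ` R \<subseteq> f ` A \<times> f ` A" if "R \<subseteq> A \<times> A" for R A
    using that by auto
  then show "is_interp I \<Longrightarrow> is_interp (transp f I)"
    by (simp add: is_interp_def transp_def image_mono)
qed

lemma subsumed_ext:
  fixes I :: "('v, 'c, 'r, 'd) interp"
  assumes "C \<sqsubseteq> D" "is_interp I"
  shows "ext I C \<subseteq> ext I D"
proof
  fix x assume "x \<in> ext I C"
  from ext_finite_witness[OF assms(2) this] obtain A where
    A: "finite A" "A \<subseteq> carr I" "x \<in> ext (restr I A) C" by blast
  have ne: "A \<noteq> {}"
  proof
    assume "A = {}"
    then have "ext (restr I A) C = {}" by (induction C) (auto simp: restr_def)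
    with A show False by simp
  qed
  note J = is_interp_restr[OF ne, of I]
  obtain f :: "'d \<Rightarrow> nat" where f: "inj_on f A"
    using finite_imp_inj_to_nat_seg[OF A(1)] by blast
  then have f': "inj_on f (carr (restr I A))" by (simp add: restr_def)
  have "f x \<in> ext (transp f (restr I A)) C"
    using A(3) by (simp add: ext_transp[OF J f'])
  then have "f x \<in> ext (transp f (restr I A)) D"
    using assms(1) is_interp_transp[OF J] unfolding subsumed_def by blast
  then obtain y where y: "f y = f x" "y \<in> ext (restr I A) D"
    by (auto simp: ext_transp[OF J f'])
  have "y = x"
    using inj_onD[OF f' y(1) subsetD[OF ext_carr[OF J] y(2)] subsetD[OF ext_carr[OF J] A(3)]] .
  with y show "x \<in> ext I D" using ext_restr_subset[OF A(2)] by blast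
qed

text \<open>For every infinite type \<open>'d\<close>, subsumption may equally be tested on the interpretations over
  \<open>'d\<close>; by \<open>subsumed_ext\<close> it implies inclusion in interpretations over any type.\<close>

lemma subsumed_iff:
  fixes C D :: "('v, 'c, 'r) concept"
  assumes "infinite (UNIV :: 'd set)"
  shows "C \<sqsubseteq> D \<longleftrightarrow> (\<forall>I :: ('v, 'c, 'r, 'd) interp. is_interp I \<longrightarrow> ext I C \<subseteq> ext I D)"
proof
  assume *: "\<forall>I :: ('v, 'c, 'r, 'd) interp. is_interp I \<longrightarrow> ext I C \<subseteq> ext I D"
  obtain f :: "nat \<Rightarrow> 'd" where f: "inj f"
    using assms infinite_countable_subset by blast
  show "C \<sqsubseteq> D"
    unfolding subsumed_def
  proof (intro allI impI)
    fix I :: "('v, 'c, 'r, nat) interp"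
    assume I: "is_interp I"
    have f': "inj_on f (carr I)" using f by (rule inj_on_subset) simp
    have "f ` ext I C \<subseteq> f ` ext I D"
      using * is_interp_transp[OF I] by (metis ext_transp[OF I f'])
    then show "ext I C \<subseteq> ext I D" using f by (simp add: inj_image_subset_iff)
  qed
qed (intro allI impI subsumed_ext)

datatype (cvars: 'v, cconstants: 'c, croles: 'r) constraint =
    Sub "('v, 'c, 'r) concept" "('v, 'c, 'r) concept"
  | Dissub "('v, 'c, 'r) concept" "('v, 'c, 'r) concept"

type_synonym ('v, 'c, 'r) problem = "('v, 'c, 'r) constraint set"

primrec subst :: "('v \<Rightarrow> ('v, 'c, 'r) concept) \<Rightarrow> ('v, 'c, 'r) concept \<Rightarrow> ('v, 'c, 'r) concept" where
  "subst \<sigma> Top = Top"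
| "subst \<sigma> (Var X) = \<sigma> X"
| "subst \<sigma> (Const A) = Const A"
| "subst \<sigma> (Conj C D) = Conj (subst \<sigma> C) (subst \<sigma> D)"
| "subst \<sigma> (Exists r C) = Exists r (subst \<sigma> C)"

definition N_v :: "('v, 'c, 'r) problem \<Rightarrow> 'v set" where
  "N_v \<Gamma> = (\<Union>c\<in>\<Gamma>. cvars c)"

definition N_c :: "('v, 'c, 'r) problem \<Rightarrow> 'c set" where
  "N_c \<Gamma> = (\<Union>c\<in>\<Gamma>. cconstants c)"

definition N_R :: "('v, 'c, 'r) problem \<Rightarrow> 'r set" where
  "N_R \<Gamma> = (\<Union>c\<in>\<Gamma>. croles c)"

text \<open>Only the values of a substitution on \<open>N_v \<Gamma>\<close> matter.\<close>

definition solution :: "('v, 'c, 'r) problem \<Rightarrow> ('v \<Rightarrow> ('v, 'c, 'r) concept) \<Rightarrow> bool" where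
  "solution \<Gamma> \<sigma> \<longleftrightarrow>
     (\<forall>X \<in> N_v \<Gamma>. vars (\<sigma> X) = {} \<and> constants (\<sigma> X) \<subseteq> N_c \<Gamma> \<and> roles (\<sigma> X) \<subseteq> N_R \<Gamma>) \<and>
     (\<forall>C D. Sub C D \<in> \<Gamma> \<longrightarrow> subst \<sigma> C \<sqsubseteq> subst \<sigma> D) \<and>
     (\<forall>C D. Dissub C D \<in> \<Gamma> \<longrightarrow> \<not> subst \<sigma> C \<sqsubseteq> subst \<sigma> D)"

fun is_name :: "('v, 'c, 'r) concept \<Rightarrow> bool" where
  "is_name (Var X) = True"
| "is_name (Const A) = True"
| "is_name _ = False"

fun is_atom :: "('v, 'c, 'r) concept \<Rightarrow> bool" where
  "is_atom (Exists r C) = True"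
| "is_atom C = is_name C"

fun flat_atom :: "('v, 'c, 'r) concept \<Rightarrow> bool" where
  "flat_atom (Exists r C) = is_name C"
| "flat_atom C = is_name C"

text \<open>The atoms \<open>C\<^sub>1, \<dots>, C\<^sub>n\<close> of a conjunction \<open>C\<^sub>1 \<sqinter> \<dots> \<sqinter> C\<^sub>n\<close>, bracketed in any way; \<open>Top\<close> is
  the conjunction with \<open>n = 0\<close>.\<close>

fun top_atoms :: "('v, 'c, 'r) concept \<Rightarrow> ('v, 'c, 'r) concept set" where
  "top_atoms Top = {}"
| "top_atoms (Conj C D) = top_atoms C \<union> top_atoms D"
| "top_atoms C = {C}"

fun flat_constraint :: "('v, 'c, 'r) constraint \<Rightarrow> bool" where
  "flat_constraint (Sub C D) \<longleftrightarrow> (\<forall>E \<in> top_atoms C. flat_atom E) \<and> flat_atom D"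
| "flat_constraint (Dissub C D) \<longleftrightarrow> (\<exists>X Y. C = Var X \<and> D = Var Y)"

definition flat_problem :: "('v, 'c, 'r) problem \<Rightarrow> bool" where
  "flat_problem \<Gamma> \<longleftrightarrow> finite \<Gamma> \<and> (\<forall>c \<in> \<Gamma>. flat_constraint c)"

primrec subterms :: "('v, 'c, 'r) concept \<Rightarrow> ('v, 'c, 'r) concept set" where
  "subterms Top = {Top}"
| "subterms (Var X) = {Var X}"
| "subterms (Const A) = {Const A}"
| "subterms (Conj C D) = insert (Conj C D) (subterms C \<union> subterms D)"
| "subterms (Exists r C) = insert (Exists r C) (subterms C)"

fun csubterms :: "('v, 'c, 'r) constraint \<Rightarrow> ('v, 'c, 'r) concept set" where
  "csubterms (Sub C D) = subterms C \<union> subterms D"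
| "csubterms (Dissub C D) = subterms C \<union> subterms D"

definition At :: "('v, 'c, 'r) problem \<Rightarrow> ('v, 'c, 'r) concept set" where
  "At \<Gamma> = {C \<in> (\<Union>c\<in>\<Gamma>. csubterms c). is_atom C}"

definition At_nv :: "('v, 'c, 'r) problem \<Rightarrow> ('v, 'c, 'r) concept set" where
  "At_nv \<Gamma> = At \<Gamma> - Var ` N_v \<Gamma>"

definition depends ::
  "('v, 'c, 'r) problem \<Rightarrow> ('v \<Rightarrow> ('v, 'c, 'r) concept set) \<Rightarrow> ('v \<times> 'v) set" where
  "depends \<Gamma> S = {(X, Y). X \<in> N_v \<Gamma> \<and> (\<exists>D \<in> S X. Y \<in> vars D)}"

definition acyclic_assignment ::
  "('v, 'c, 'r) problem \<Rightarrow> ('v \<Rightarrow> ('v, 'c, 'r) concept set) \<Rightarrow> bool" where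
  "acyclic_assignment \<Gamma> S \<longleftrightarrow> (\<forall>X \<in> N_v \<Gamma>. S X \<subseteq> At_nv \<Gamma>) \<and> irrefl ((depends \<Gamma> S)\<^sup>+)"

fun conj_list :: "('v, 'c, 'r) concept list \<Rightarrow> ('v, 'c, 'r) concept" where
  "conj_list [] = Top"
| "conj_list [D] = D"
| "conj_list (D # E # Ds) = Conj D (conj_list (E # Ds))"

definition enum_set :: "'a set \<Rightarrow> 'a list" where
  "enum_set A = (SOME xs. set xs = A \<and> distinct xs)"

text \<open>The substitution \<open>\<sigma>\<^sub>S\<close>, by recursion along the dependency order; its defining equation is the
  lemma \<open>sigma_eq\<close>. As \<open>S X\<close> is a set, an order of the conjuncts is fixed arbitrarily.\<close>

definition sigma ::
  "('v, 'c, 'r) problem \<Rightarrow> ('v \<Rightarrow> ('v, 'c, 'r) concept set) \<Rightarrow> 'v \<Rightarrow> ('v, 'c, 'r) concept" where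
  "sigma \<Gamma> S = wfrec ((depends \<Gamma> S)\<inverse>) (\<lambda>\<sigma> X. conj_list (map (subst \<sigma>) (enum_set (S X))))"

definition local_solution :: "('v, 'c, 'r) problem \<Rightarrow> ('v \<Rightarrow> ('v, 'c, 'r) concept) \<Rightarrow> bool" where
  "local_solution \<Gamma> \<sigma> \<longleftrightarrow> solution \<Gamma> \<sigma> \<and>
     (\<exists>S. acyclic_assignment \<Gamma> S \<and> (\<forall>X \<in> N_v \<Gamma>. \<sigma> X = sigma \<Gamma> S X))"

lemma set_enum_set: "finite A \<Longrightarrow> set (enum_set A) = A \<and> distinct (enum_set A)"
  unfolding enum_set_def by (rule someI_ex) (rule finite_distinct_list)

lemma subst_cong: "(\<And>X. X \<in> vars C \<Longrightarrow> \<sigma> X = \<tau> X) \<Longrightarrow> subst \<sigma> C = subst \<tau> C"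
  by (induction C) auto

lemma finite_vars: "finite (vars C)"
  by (induction C) auto

lemma finite_cvars: "finite (cvars c)"
  by (cases c) (auto simp: finite_vars)

lemma finite_subterms: "finite (subterms C)"
  by (induction C) auto

lemma vars_subterms: "D \<in> subterms C \<Longrightarrow> vars D \<subseteq> vars C"
  by (induction C) auto

lemma finite_At: "finite \<Gamma> \<Longrightarrow> finite (At \<Gamma>)"
proof -
  have "finite (csubterms c)" for c :: "('a, 'b, 'c) constraint"
    by (cases c) (auto simp: finite_subterms)
  then show "finite \<Gamma> \<Longrightarrow> finite (At \<Gamma>)" by (auto simp: At_def)
qed

lemma vars_At: "D \<in> At \<Gamma> \<Longrightarrow> vars D \<subseteq> N_v \<Gamma>"
proof -
  have "vars D \<subseteq> cvars c" if "D \<in> csubterms c" for c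
    using that by (cases c) (auto dest: vars_subterms)
  then show "D \<in> At \<Gamma> \<Longrightarrow> vars D \<subseteq> N_v \<Gamma>" by (fastforce simp: At_def N_v_def)
qed

lemma sigma_eq:
  assumes "finite \<Gamma>" "acyclic_assignment \<Gamma> S" "X \<in> N_v \<Gamma>"
  shows "sigma \<Gamma> S X = conj_list (map (subst (sigma \<Gamma> S)) (enum_set (S X)))"
proof -
  have "depends \<Gamma> S \<subseteq> N_v \<Gamma> \<times> N_v \<Gamma>"
    using assms(2) vars_At unfolding depends_def acyclic_assignment_def At_nv_def by fastforce
  moreover have "finite (N_v \<Gamma>)"
    using assms(1) by (auto simp: N_v_def finite_cvars)
  ultimately have "finite (depends \<Gamma> S)"
    by (metis finite_SigmaI finite_subset)
  moreover have "acyclic (depends \<Gamma> S)"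
    using assms(2) by (auto simp: acyclic_assignment_def acyclic_def irrefl_def)
  ultimately have wf: "wf ((depends \<Gamma> S)\<inverse>)"
    by (rule finite_acyclic_wf_converse)
  have fin: "finite (S X)"
    using assms finite_At[OF assms(1)]
    by (auto simp: acyclic_assignment_def At_nv_def intro: finite_subset)
  have *: "subst (cut \<sigma> ((depends \<Gamma> S)\<inverse>) X) D = subst \<sigma> D" if "D \<in> S X" for \<sigma> D
  proof (rule subst_cong)
    fix Y assume "Y \<in> vars D"
    then have "(Y, X) \<in> (depends \<Gamma> S)\<inverse>" using that assms(3) by (auto simp: depends_def)
    then show "cut \<sigma> ((depends \<Gamma> S)\<inverse>) X Y = \<sigma> Y" by (rule cut_apply)
  qed
  then have "map (subst (cut \<sigma> ((depends \<Gamma> S)\<inverse>) X)) (enum_set (S X)) =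
      map (subst \<sigma>) (enum_set (S X))" for \<sigma>
    by (intro map_cong refl *) (simp add: set_enum_set[OF fin])
  then show ?thesis
    unfolding sigma_def by (subst wfrec[OF wf]) (rule arg_cong)
qed

datatype 'p literal = Pos 'p | Neg 'p

type_synonym 'p clause = "'p literal set"

primrec lit_true :: "('p \<Rightarrow> bool) \<Rightarrow> 'p literal \<Rightarrow> bool" where
  "lit_true \<tau> (Pos p) \<longleftrightarrow> \<tau> p"
| "lit_true \<tau> (Neg p) \<longleftrightarrow> \<not> \<tau> p"

definition satisfiable :: "'p clause set \<Rightarrow> bool" where
  "satisfiable \<Phi> \<longleftrightarrow> (\<exists>\<tau>. \<forall>K \<in> \<Phi>. \<exists>l \<in> K. lit_true \<tau> l)"

text \<open>The clause \<open>p\<^sub>1 \<and> \<dots> \<and> p\<^sub>m \<longrightarrow> q\<^sub>1 \<or> \<dots> \<or> q\<^sub>n\<close>; a clause \<open>\<not> (p \<and> q)\<close> is written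
  \<open>{p, q} \<leadsto> {}\<close>.\<close>

definition clause :: "'p set \<Rightarrow> 'p set \<Rightarrow> 'p clause" (infix "\<leadsto>" 55) where
  "P \<leadsto> Q = Neg ` P \<union> Pos ` Q"

text \<open>The propositional variables \<open>[C \<sqsubseteq> D]\<close>, \<open>[X > Y]\<close> and \<open>p\<^bsub>C,X,D\<^esub>\<close>.\<close>

datatype ('v, 'c, 'r) pvar =
    PSub "('v, 'c, 'r) concept" "('v, 'c, 'r) concept"  ("[_ \<sqsubseteq>\<^sub>p _]")
  | PGt 'v 'v  ("[_ >\<^sub>p _]")
  | PNot "('v, 'c, 'r) concept" 'v "('v, 'c, 'r) concept"

inductive_set Cl :: "('v, 'c, 'r) problem \<Rightarrow> ('v, 'c, 'r) pvar clause set"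
  for \<Gamma> :: "('v, 'c, 'r) problem" where
  Ia: "Sub C D \<in> \<Gamma> \<Longrightarrow> D \<in> At_nv \<Gamma> \<Longrightarrow>
    {} \<leadsto> {[E \<sqsubseteq>\<^sub>p D] | E. E \<in> top_atoms C} \<in> Cl \<Gamma>"
| Ib: "Sub C (Var X) \<in> \<Gamma> \<Longrightarrow> X \<in> N_v \<Gamma> \<Longrightarrow> E \<in> At_nv \<Gamma> \<Longrightarrow>
    {[Var X \<sqsubseteq>\<^sub>p E]} \<leadsto> {[F \<sqsubseteq>\<^sub>p E] | F. F \<in> top_atoms C} \<in> Cl \<Gamma>"
| Ic: "Dissub (Var X) (Var Y) \<in> \<Gamma> \<Longrightarrow>
    {[Var X \<sqsubseteq>\<^sub>p Var Y]} \<leadsto> {} \<in> Cl \<Gamma>"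
| IIa: "A \<in> N_c \<Gamma> \<Longrightarrow>
    {} \<leadsto> {[Const A \<sqsubseteq>\<^sub>p Const A]} \<in> Cl \<Gamma>"
| IIb: "A \<in> N_c \<Gamma> \<Longrightarrow> B \<in> N_c \<Gamma> \<Longrightarrow> A \<noteq> B \<Longrightarrow>
    {[Const A \<sqsubseteq>\<^sub>p Const B]} \<leadsto> {} \<in> Cl \<Gamma>"
| IIc: "Exists r A \<in> At_nv \<Gamma> \<Longrightarrow> Exists s B \<in> At_nv \<Gamma> \<Longrightarrow> r \<noteq> s \<Longrightarrow>
    {[Exists r A \<sqsubseteq>\<^sub>p Exists s B]} \<leadsto> {} \<in> Cl \<Gamma>"
| IId1: "A \<in> N_c \<Gamma> \<Longrightarrow> Exists r B \<in> At_nv \<Gamma> \<Longrightarrow>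
    {[Const A \<sqsubseteq>\<^sub>p Exists r B]} \<leadsto> {} \<in> Cl \<Gamma>"
| IId2: "A \<in> N_c \<Gamma> \<Longrightarrow> Exists r B \<in> At_nv \<Gamma> \<Longrightarrow>
    {[Exists r B \<sqsubseteq>\<^sub>p Const A]} \<leadsto> {} \<in> Cl \<Gamma>"
| IIe1: "Exists r A \<in> At_nv \<Gamma> \<Longrightarrow> Exists r B \<in> At_nv \<Gamma> \<Longrightarrow>
    {[Exists r A \<sqsubseteq>\<^sub>p Exists r B]} \<leadsto> {[A \<sqsubseteq>\<^sub>p B]} \<in> Cl \<Gamma>"
| IIe2: "Exists r A \<in> At_nv \<Gamma> \<Longrightarrow> Exists r B \<in> At_nv \<Gamma> \<Longrightarrow>
    {[A \<sqsubseteq>\<^sub>p B]} \<leadsto> {[Exists r A \<sqsubseteq>\<^sub>p Exists r B]} \<in> Cl \<Gamma>"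
| III: "C\<^sub>1 \<in> At \<Gamma> \<Longrightarrow> C\<^sub>2 \<in> At \<Gamma> \<Longrightarrow> C\<^sub>3 \<in> At \<Gamma> \<Longrightarrow>
    {[C\<^sub>1 \<sqsubseteq>\<^sub>p C\<^sub>2], [C\<^sub>2 \<sqsubseteq>\<^sub>p C\<^sub>3]} \<leadsto> {[C\<^sub>1 \<sqsubseteq>\<^sub>p C\<^sub>3]} \<in> Cl \<Gamma>"
| IV1: "C \<in> At \<Gamma> \<Longrightarrow> X \<in> N_v \<Gamma> \<Longrightarrow>
    {} \<leadsto> insert [C \<sqsubseteq>\<^sub>p Var X] {PNot C X D | D. D \<in> At_nv \<Gamma>} \<in> Cl \<Gamma>"
| IV2: "C \<in> At \<Gamma> \<Longrightarrow> X \<in> N_v \<Gamma> \<Longrightarrow> D \<in> At_nv \<Gamma> \<Longrightarrow>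
    {PNot C X D} \<leadsto> {[Var X \<sqsubseteq>\<^sub>p D]} \<in> Cl \<Gamma>"
| IV3: "C \<in> At \<Gamma> \<Longrightarrow> X \<in> N_v \<Gamma> \<Longrightarrow> D \<in> At_nv \<Gamma> \<Longrightarrow>
    {PNot C X D, [C \<sqsubseteq>\<^sub>p D]} \<leadsto> {} \<in> Cl \<Gamma>"
| Va: "X \<in> N_v \<Gamma> \<Longrightarrow>
    {[X >\<^sub>p X]} \<leadsto> {} \<in> Cl \<Gamma>"
| Vb: "X \<in> N_v \<Gamma> \<Longrightarrow> Y \<in> N_v \<Gamma> \<Longrightarrow> Z \<in> N_v \<Gamma> \<Longrightarrow>
    {[X >\<^sub>p Y], [Y >\<^sub>p Z]} \<leadsto> {[X >\<^sub>p Z]} \<in> Cl \<Gamma>"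
| Vc: "X \<in> N_v \<Gamma> \<Longrightarrow> Y \<in> N_v \<Gamma> \<Longrightarrow> Exists r (Var Y) \<in> At \<Gamma> \<Longrightarrow>
    {[Var X \<sqsubseteq>\<^sub>p Exists r (Var Y)]} \<leadsto> {[X >\<^sub>p Y]} \<in> Cl \<Gamma>"

end

theory Submission imports Defs begin

text \<open>Subsumption \<open>C \<sqsubseteq> D\<close> is decided in the canonical interpretation on concept terms, which yields
  its structural characterization. A local solution \<open>\<sigma>\<close> induces a valuation reading \<open>[C \<sqsubseteq> D]\<close> as
  \<open>\<sigma>(C) \<sqsubseteq> \<sigma>(D)\<close> and \<open>[X > Y]\<close> as a comparison of the role depths of \<open>\<sigma>(X)\<close> and \<open>\<sigma>(Y)\<close>. Conversely, a
  satisfying valuation \<open>\<tau>\<close> induces the assignment \<open>S\<^sub>X = {D. \<tau> [X \<sqsubseteq> D]}\<close>, and \<open>\<tau> [C \<sqsubseteq> D]\<close> is then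
  equivalent to \<open>\<sigma>\<^sub>S(C) \<sqsubseteq> \<sigma>\<^sub>S(D)\<close> for all atoms. One implication needs no induction because the
  atoms are flat; the other goes by induction on the role depth of \<open>\<sigma>\<^sub>S(D)\<close>.\<close>

section \<open>Structural characterization of subsumption\<close>

text \<open>The elements are the concept terms themselves. Names and successors of a term are read
  off its top-level conjuncts, so membership in an extension becomes a syntactic condition.\<close>

definition canon :: "('v, 'c, 'r, ('v, 'c, 'r) concept) interp" where
  "canon = \<lparr>carr = UNIV, ivar = (\<lambda>X. {C. Var X \<in> top_atoms C}),
     iconst = (\<lambda>A. {C. Const A \<in> top_atoms C}),
     irole = (\<lambda>r. {(C, D). Exists r D \<in> top_atoms C})\<rparr>"

lemma is_interp_canon: "is_interp canon"
  by (auto simp: is_interp_def canon_def)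

lemma ext_canon_mono:
  "top_atoms C \<subseteq> top_atoms C' \<Longrightarrow> C \<in> ext canon D \<Longrightarrow> C' \<in> ext canon D"
  by (induction D) (auto simp: canon_def)

lemma ext_canon_self: "C \<in> ext canon C"
proof (induction C)
  case (Conj C D)
  then show ?case
    using ext_canon_mono[of C "Conj C D"] ext_canon_mono[of D "Conj C D"] by simp
qed (auto simp: canon_def)

lemma subsumed_top_atom:
  fixes C D :: "('v, 'c, 'r) concept"
  shows "D \<in> top_atoms C \<Longrightarrow> C \<sqsubseteq> D"
proof (induction C)
  case (Conj C E)
  then show ?case by (auto simp: subsumed_def)
qed (auto simp: subsumed_def)

lemma subsumed_refl [simp]: "C \<sqsubseteq> C"
  by (simp add: subsumed_def)

lemma subsumed_trans [trans]: "C \<sqsubseteq> D \<Longrightarrow> D \<sqsubseteq> E \<Longrightarrow> C \<sqsubseteq> E"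
  unfolding subsumed_def by (meson subset_trans)

lemma subsumed_Top: "C \<sqsubseteq> Top"
  using ext_carr by (auto simp: subsumed_def)

lemma subsumed_Conj: "C \<sqsubseteq> Conj D E \<longleftrightarrow> C \<sqsubseteq> D \<and> C \<sqsubseteq> E"
  by (auto simp: subsumed_def)

lemma subsumed_Exists_mono: "C \<sqsubseteq> D \<Longrightarrow> Exists r C \<sqsubseteq> Exists r D"
  by (auto simp: subsumed_def dest: subsetD)

text \<open>In the existential case the successor is the filler \<open>E\<close> of a top-level
  conjunct of \<open>C\<close>, and the induction hypothesis for \<open>E\<close> lifts through the
  role by monotonicity.\<close>

lemma ext_canon_imp_subsumed: "C \<in> ext canon D \<Longrightarrow> C \<sqsubseteq> D"
proof (induction D arbitrary: C)
  case (Exists r D)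
  then obtain E where "Exists r E \<in> top_atoms C" "E \<in> ext canon D"
    by (auto simp: canon_def)
  then show ?case
    by (intro subsumed_trans[OF subsumed_top_atom subsumed_Exists_mono] Exists.IH)
qed (auto simp: canon_def subsumed_Top subsumed_Conj intro: subsumed_top_atom)

text \<open>From left to right, evaluate in \<open>canon\<close> at the element \<open>C\<close>,
  which lies in its own extension. The domain of \<open>canon\<close> is not \<open>nat\<close>,
  hence the use of \<open>subsumed_ext\<close>.\<close>

lemma subsumed_iff_canon: "C \<sqsubseteq> D \<longleftrightarrow> C \<in> ext canon D"
  using ext_canon_imp_subsumed subsumed_ext[OF _ is_interp_canon, of C D] ext_canon_self[of C]
  by (auto dest: subsetD)

lemma subsumed_Const_iff: "C \<sqsubseteq> Const A \<longleftrightarrow> Const A \<in> top_atoms C"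
  unfolding subsumed_iff_canon by (simp add: canon_def)

lemma subsumed_Exists_iff: "C \<sqsubseteq> Exists r D \<longleftrightarrow> (\<exists>E. Exists r E \<in> top_atoms C \<and> E \<sqsubseteq> D)"
  unfolding subsumed_iff_canon by (simp add: canon_def)

lemma subsumed_conj_list: "C \<sqsubseteq> conj_list Ds \<longleftrightarrow> (\<forall>D \<in> set Ds. C \<sqsubseteq> D)"
  by (induction Ds rule: conj_list.induct) (auto simp: subsumed_Top subsumed_Conj)

lemma top_atoms_conj_list: "top_atoms (conj_list Ds) = (\<Union>D \<in> set Ds. top_atoms D)"
  by (induction Ds rule: conj_list.induct) auto

lemma top_atoms_subst: "top_atoms (subst \<sigma> C) = (\<Union>E \<in> top_atoms C. top_atoms (subst \<sigma> E))"
  by (induction C) auto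

lemma subst_subsumed_top_atom: "E \<in> top_atoms C \<Longrightarrow> subst \<sigma> C \<sqsubseteq> subst \<sigma> E"
proof (induction C)
  case (Conj C D)
  moreover have "subst \<sigma> (Conj C D) \<sqsubseteq> subst \<sigma> C" "subst \<sigma> (Conj C D) \<sqsubseteq> subst \<sigma> D"
    by (simp_all add: subsumed_def)
  ultimately show ?case by (auto intro: subsumed_trans[of _ "subst \<sigma> C"] subsumed_trans[of _ "subst \<sigma> D"])
qed auto

section \<open>Role depth\<close>

primrec role_depth :: "('v, 'c, 'r) concept \<Rightarrow> nat" where
  "role_depth Top = 0"
| "role_depth (Var X) = 0"
| "role_depth (Const A) = 0"
| "role_depth (Conj C D) = max (role_depth C) (role_depth D)"
| "role_depth (Exists r C) = Suc (role_depth C)"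

lemma role_depth_top_atom: "D \<in> top_atoms C \<Longrightarrow> role_depth D \<le> role_depth C"
  by (induction C) (auto intro: max.coboundedI1 max.coboundedI2)

text \<open>An existential restriction on the right is matched by a conjunct of \<open>C\<close>
  whose filler is subsumed by its own, so nesting is never lost. This justifies clause
  \<open>Vc\<close> and bounds the induction in \<open>subsumed_imp_tau\<close>.\<close>

lemma role_depth_subsumed: "C \<sqsubseteq> D \<Longrightarrow> role_depth D \<le> role_depth C"
proof (induction D arbitrary: C)
  case (Exists r D)
  then obtain E where "Exists r E \<in> top_atoms C" "E \<sqsubseteq> D"
    by (auto simp: subsumed_Exists_iff)
  then show ?case using Exists.IH[of E] role_depth_top_atom[of "Exists r E" C] by simp
qed (auto simp: subsumed_Conj)

section \<open>Clauses and the atoms of a flat problem\<close>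

lemma lit_true_clause:
  "(\<exists>l \<in> P \<leadsto> Q. lit_true \<tau> l) \<longleftrightarrow> ((\<forall>p \<in> P. \<tau> p) \<longrightarrow> (\<exists>q \<in> Q. \<tau> q))"
  by (simp add: clause_def bex_Un) blast

lemma bex_Collect_image: "(\<exists>q \<in> {f E | E. P E}. Q q) \<longleftrightarrow> (\<exists>E. P E \<and> Q (f E))"
  by blast

lemma is_name_cases:
  assumes "is_name C"
  obtains (Var) X where "C = Var X" | (Const) A where "C = Const A"
  using assms by (cases C) auto

lemma top_atoms_subterms: "top_atoms C \<subseteq> subterms C"
  by (induction C) auto

lemma is_atom_top_atom: "E \<in> top_atoms C \<Longrightarrow> is_atom E"
  by (induction C) auto

text \<open>In the existential case the premise makes the filler a name, which is the only proper
  subterm and is itself flat.\<close>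

lemma flat_atom_subterm:
  "\<forall>E \<in> top_atoms C. flat_atom E \<Longrightarrow> D \<in> subterms C \<Longrightarrow> is_atom D \<Longrightarrow> flat_atom D"
proof (induction C)
  case (Exists r C)
  then show ?case by (cases C) auto
qed auto

lemma constants_subterms: "D \<in> subterms C \<Longrightarrow> constants D \<subseteq> constants C"
  by (induction C) auto

lemma roles_subterms: "D \<in> subterms C \<Longrightarrow> roles D \<subseteq> roles C"
  by (induction C) auto

lemma subterms_trans: "D \<in> subterms C \<Longrightarrow> E \<in> subterms D \<Longrightarrow> E \<in> subterms C"
  by (induction C) auto

lemma subterms_refl [simp]: "C \<in> subterms C"
  by (cases C) auto

lemma flat_atom_top_atoms: "flat_atom D \<Longrightarrow> top_atoms D = {D}"
  by (cases D) auto

lemma At_flat: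
  assumes "flat_problem \<Gamma>" "D \<in> At \<Gamma>"
  shows "flat_atom D"
proof -
  obtain c where c: "c \<in> \<Gamma>" "D \<in> csubterms c" "is_atom D"
    using assms(2) by (auto simp: At_def)
  have "flat_constraint c" using assms(1) c(1) by (simp add: flat_problem_def)
  moreover have "flat_atom D" if "flat_atom E" "D \<in> subterms E" for E
    using flat_atom_subterm[of E D] that c(3) by (simp add: flat_atom_top_atoms)
  ultimately show ?thesis using c by (cases c) (auto dest: flat_atom_subterm)
qed

lemma At_constants: "D \<in> At \<Gamma> \<Longrightarrow> constants D \<subseteq> N_c \<Gamma>"
proof -
  have "constants D \<subseteq> cconstants c" if "D \<in> csubterms c" for c
    using that by (cases c) (auto dest: constants_subterms)
  then show "D \<in> At \<Gamma> \<Longrightarrow> constants D \<subseteq> N_c \<Gamma>" by (fastforce simp: At_def N_c_def)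
qed

lemma At_roles: "D \<in> At \<Gamma> \<Longrightarrow> roles D \<subseteq> N_R \<Gamma>"
proof -
  have "roles D \<subseteq> croles c" if "D \<in> csubterms c" for c
    using that by (cases c) (auto dest: roles_subterms)
  then show "D \<in> At \<Gamma> \<Longrightarrow> roles D \<subseteq> N_R \<Gamma>" by (fastforce simp: At_def N_R_def)
qed

lemma At_subterm: "D \<in> At \<Gamma> \<Longrightarrow> E \<in> subterms D \<Longrightarrow> is_atom E \<Longrightarrow> E \<in> At \<Gamma>"
proof -
  have "E \<in> csubterms c" if "D \<in> csubterms c" "E \<in> subterms D" for c
    using that by (cases c) (auto intro: subterms_trans)
  then show "D \<in> At \<Gamma> \<Longrightarrow> E \<in> subterms D \<Longrightarrow> is_atom E \<Longrightarrow> E \<in> At \<Gamma>"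
    by (auto simp: At_def)
qed

lemma is_name_atom: "is_name C \<Longrightarrow> is_atom C"
  by (cases C) auto

lemma At_Exists:
  assumes "flat_problem \<Gamma>" "Exists r A \<in> At \<Gamma>"
  shows "A \<in> At \<Gamma>" "is_name A"
proof -
  show "is_name A" using At_flat[OF assms] by simp
  then show "A \<in> At \<Gamma>" using At_subterm[OF assms(2), of A] is_name_atom[of A] by simp
qed

lemma At_Sub_left: "Sub C D \<in> \<Gamma> \<Longrightarrow> E \<in> top_atoms C \<Longrightarrow> E \<in> At \<Gamma>"
  using top_atoms_subterms is_atom_top_atom unfolding At_def by fastforce

lemma At_Sub_right: "flat_problem \<Gamma> \<Longrightarrow> Sub C D \<in> \<Gamma> \<Longrightarrow> D \<in> At \<Gamma>"
proof -
  assume "flat_problem \<Gamma>" "Sub C D \<in> \<Gamma>"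
  moreover from this have "is_atom D"
    by (cases D) (auto simp: flat_problem_def dest!: bspec)
  ultimately show "D \<in> At \<Gamma>" by (force simp: At_def)
qed

lemma At_Dissub: "Dissub (Var X) (Var Y) \<in> \<Gamma> \<Longrightarrow> Var X \<in> At \<Gamma> \<and> Var Y \<in> At \<Gamma>"
  by (force simp: At_def)

lemma At_cases [consumes 1, case_names Var Nonvar]:
  assumes "D \<in> At \<Gamma>"
  obtains X where "D = Var X" "X \<in> N_v \<Gamma>" | "D \<in> At_nv \<Gamma>"
  using assms vars_At[OF assms] by (auto simp: At_nv_def)

lemma At_nv_At: "D \<in> At_nv \<Gamma> \<Longrightarrow> D \<in> At \<Gamma>"
  by (simp add: At_nv_def)

text \<open>By flatness the filler is a name and again an atom of \<Gamma>, so statements about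
  \<open>At \<Gamma>\<close> apply to it.\<close>

lemma At_nv_cases [consumes 2, case_names Const Exists]:
  assumes "flat_problem \<Gamma>" "D \<in> At_nv \<Gamma>"
  obtains A where "D = Const A" "A \<in> N_c \<Gamma>"
  | r A where "D = Exists r A" "A \<in> At \<Gamma>" "is_name A"
proof (cases D)
  case (Var X)
  then show thesis using assms(2) vars_At[of D \<Gamma>] by (auto simp: At_nv_def)
next
  case (Const A)
  then show thesis using assms(2) At_constants[of D \<Gamma>] that by (auto simp: At_nv_def)
next
  case (Exists r A)
  then show thesis
    using At_Exists[OF assms(1), of r A] assms(2) that(2) by (simp add: At_nv_def)
qed (use assms(2) in \<open>auto simp: At_nv_def At_def\<close>)

text \<open>A substitution keeps the outermost constructor of a non-variable atom. Its image is
  therefore matched by a single top-level conjunct of \<open>subst \<sigma> C\<close>, and that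
  conjunct stems from one atom of \<open>C\<close>. This is the content of the disjunctions in
  \<open>Ia\<close> and \<open>Ib\<close>.\<close>

lemma subst_subsumed_nonvar:
  assumes "flat_problem \<Gamma>" "D \<in> At_nv \<Gamma>" "subst \<sigma> C \<sqsubseteq> subst \<sigma> D"
  shows "\<exists>E \<in> top_atoms C. subst \<sigma> E \<sqsubseteq> subst \<sigma> D"
  using assms(1,2)
proof (cases rule: At_nv_cases)
  case (Const A)
  then show ?thesis using assms(3) by (simp add: subsumed_Const_iff top_atoms_subst[of \<sigma> C])
next
  case (Exists r A)
  then show ?thesis using assms(3)
    by (auto simp: subsumed_Exists_iff top_atoms_subst[of \<sigma> C])
qed

section \<open>The substitution induced by an acyclic assignment\<close>

text \<open>One unfolding of \<open>sigma_eq\<close>; both properties depend only on the set of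
  conjuncts, so the arbitrary order chosen by \<open>enum_set\<close> disappears.\<close>

lemma
  assumes "finite \<Gamma>" "acyclic_assignment \<Gamma> S" "X \<in> N_v \<Gamma>"
  shows subsumed_sigma_iff: "C \<sqsubseteq> sigma \<Gamma> S X \<longleftrightarrow> (\<forall>D \<in> S X. C \<sqsubseteq> subst (sigma \<Gamma> S) D)"
    and top_atoms_sigma:
      "top_atoms (sigma \<Gamma> S X) = (\<Union>D \<in> S X. top_atoms (subst (sigma \<Gamma> S) D))"
    and set_enum_assignment: "set (enum_set (S X)) = S X"
proof -
  have "finite (S X)"
    using assms finite_At[OF assms(1)]
    by (auto simp: acyclic_assignment_def At_nv_def intro: finite_subset)
  then show "set (enum_set (S X)) = S X" by (simp add: set_enum_set)
  then show "C \<sqsubseteq> sigma \<Gamma> S X \<longleftrightarrow> (\<forall>D \<in> S X. C \<sqsubseteq> subst (sigma \<Gamma> S) D)"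
    and "top_atoms (sigma \<Gamma> S X) = (\<Union>D \<in> S X. top_atoms (subst (sigma \<Gamma> S) D))"
    by (simp_all add: sigma_eq[OF assms] subsumed_conj_list top_atoms_conj_list)
qed

lemma names_subst:
  "vars (subst \<sigma> C) = (\<Union>X \<in> vars C. vars (\<sigma> X))"
  "constants (subst \<sigma> C) = constants C \<union> (\<Union>X \<in> vars C. constants (\<sigma> X))"
  "roles (subst \<sigma> C) = roles C \<union> (\<Union>X \<in> vars C. roles (\<sigma> X))"
  by (induction C) auto

lemma names_conj_list:
  "vars (conj_list Ds) = (\<Union>D \<in> set Ds. vars D)"
  "constants (conj_list Ds) = (\<Union>D \<in> set Ds. constants D)"
  "roles (conj_list Ds) = (\<Union>D \<in> set Ds. roles D)"
  by (induction Ds rule: conj_list.induct) auto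

text \<open>Acyclicity on the finite set of variables makes the converse dependency relation
  well-founded. Along it, every variable in an atom of \<open>S X\<close> is replaced by a ground
  term, and all other names come from atoms of \<Gamma>.\<close>

lemma sigma_names:
  assumes "finite \<Gamma>" "acyclic_assignment \<Gamma> S" "X \<in> N_v \<Gamma>"
  shows "vars (sigma \<Gamma> S X) = {} \<and> constants (sigma \<Gamma> S X) \<subseteq> N_c \<Gamma> \<and>
    roles (sigma \<Gamma> S X) \<subseteq> N_R \<Gamma>"
proof -
  have S_At: "D \<in> At \<Gamma>" if "X \<in> N_v \<Gamma>" "D \<in> S X" for X D
    using assms(2) that by (auto simp: acyclic_assignment_def At_nv_def)
  have "depends \<Gamma> S \<subseteq> N_v \<Gamma> \<times> N_v \<Gamma>"
    using S_At vars_At unfolding depends_def by fastforce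
  moreover have "finite (N_v \<Gamma>)"
    using assms(1) by (auto simp: N_v_def finite_cvars)
  ultimately have "finite (depends \<Gamma> S)"
    by (metis finite_SigmaI finite_subset)
  moreover have "acyclic (depends \<Gamma> S)"
    using assms(2) by (auto simp: acyclic_assignment_def acyclic_def irrefl_def)
  ultimately have "wf ((depends \<Gamma> S)\<inverse>)"
    by (rule finite_acyclic_wf_converse)
  then show ?thesis using assms(3)
  proof (induction X rule: wf_induct_rule)
    case (less X)
    have IH: "vars (sigma \<Gamma> S Y) = {} \<and> constants (sigma \<Gamma> S Y) \<subseteq> N_c \<Gamma> \<and>
        roles (sigma \<Gamma> S Y) \<subseteq> N_R \<Gamma>" if "D \<in> S X" "Y \<in> vars D" for D Y
      using less.IH[of Y] that less.prems vars_At[OF S_At[OF less.prems that(1)]]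
      by (auto simp: depends_def)
    have "vars (subst (sigma \<Gamma> S) D) = {} \<and> constants (subst (sigma \<Gamma> S) D) \<subseteq> N_c \<Gamma> \<and>
        roles (subst (sigma \<Gamma> S) D) \<subseteq> N_R \<Gamma>" if D: "D \<in> S X" for D
      using IH[OF D] At_constants[OF S_At[OF less.prems D]] At_roles[OF S_At[OF less.prems D]]
      unfolding names_subst by blast
    then show ?case
      unfolding sigma_eq[OF assms(1,2) less.prems] names_conj_list set_map
        set_enum_assignment[OF assms(1,2) less.prems]
      by blast
  qed
qed

section \<open>From a local solution to a satisfying valuation\<close>

text \<open>\<open>PNot C X D\<close> expresses that \<open>D\<close> witnesses the failure of
  \<open>C \<sqsubseteq> X\<close>, which makes \<open>IV2\<close> and \<open>IV3\<close>
  immediate.\<close>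

primrec valuation ::
  "('v \<Rightarrow> ('v, 'c, 'r) concept) \<Rightarrow> ('v, 'c, 'r) pvar \<Rightarrow> bool" where
  "valuation \<sigma> [C \<sqsubseteq>\<^sub>p D] \<longleftrightarrow> subst \<sigma> C \<sqsubseteq> subst \<sigma> D"
| "valuation \<sigma> [X >\<^sub>p Y] \<longleftrightarrow> role_depth (\<sigma> Y) < role_depth (\<sigma> X)"
| "valuation \<sigma> (PNot C X D) \<longleftrightarrow> \<sigma> X \<sqsubseteq> subst \<sigma> D \<and> \<not> subst \<sigma> C \<sqsubseteq> subst \<sigma> D"

text \<open>This is where locality enters: \<sigma> maps \<open>X\<close> to the conjunction of the
  images of the atoms in \<open>S X\<close>. These atoms are non-variable and their images subsume
  \<open>\<sigma> X\<close>, so the last premise applies to each of them.\<close>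

lemma local_solution_nonvar:
  assumes "flat_problem \<Gamma>" "local_solution \<Gamma> \<sigma>" "X \<in> N_v \<Gamma>"
    "\<And>D. D \<in> At_nv \<Gamma> \<Longrightarrow> \<sigma> X \<sqsubseteq> subst \<sigma> D \<Longrightarrow> C \<sqsubseteq> subst \<sigma> D"
  shows "C \<sqsubseteq> \<sigma> X"
proof -
  obtain S where S: "acyclic_assignment \<Gamma> S" and eq: "\<And>X. X \<in> N_v \<Gamma> \<Longrightarrow> \<sigma> X = sigma \<Gamma> S X"
    using assms(2) by (auto simp: local_solution_def)
  have fin: "finite \<Gamma>" using assms(1) by (simp add: flat_problem_def)
  \<comment> \<open>The two substitutions are known to agree only on \<open>N_v \<Gamma>\<close>,
    which contains all variables of atoms.\<close>
  have "subst (sigma \<Gamma> S) D = subst \<sigma> D" if "D \<in> S X" for D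
  proof (rule subst_cong)
    have "D \<in> At \<Gamma>" using S assms(3) that by (auto simp: acyclic_assignment_def At_nv_def)
    then show "sigma \<Gamma> S Y = \<sigma> Y" if "Y \<in> vars D" for Y
      using that vars_At eq by fastforce
  qed
  then have *: "C' \<sqsubseteq> \<sigma> X \<longleftrightarrow> (\<forall>D \<in> S X. C' \<sqsubseteq> subst \<sigma> D)" for C'
    using subsumed_sigma_iff[OF fin S assms(3)] eq[OF assms(3)] by simp
  have "S X \<subseteq> At_nv \<Gamma>" using S assms(3) by (simp add: acyclic_assignment_def)
  then show ?thesis using * assms(4) subsumed_refl by blast
qed

lemma valuation_satisfies_Cl:
  assumes flat: "flat_problem \<Gamma>" and sol: "local_solution \<Gamma> \<sigma>" and "K \<in> Cl \<Gamma>"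
  shows "\<exists>l \<in> K. lit_true (valuation \<sigma>) l"
proof -
  have Sub: "subst \<sigma> C \<sqsubseteq> subst \<sigma> D" if "Sub C D \<in> \<Gamma>" for C D
    using sol that by (auto simp: local_solution_def solution_def)
  have Dissub: "\<not> subst \<sigma> C \<sqsubseteq> subst \<sigma> D" if "Dissub C D \<in> \<Gamma>" for C D
    using sol that by (auto simp: local_solution_def solution_def)
  from \<open>K \<in> Cl \<Gamma>\<close> show ?thesis
  proof cases
    case (Ia C D)
    show ?thesis using subst_subsumed_nonvar[OF flat Ia(3) Sub[OF Ia(2)]]
      unfolding Ia(1) lit_true_clause bex_Collect_image by auto
  next
    case (Ib C X E)
    \<comment> \<open>The constraint gives \<open>subst \<sigma> C \<sqsubseteq> \<sigma> X\<close>;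
      composing with the assumption puts a non-variable atom on the right.\<close>
    have "\<exists>F \<in> top_atoms C. subst \<sigma> F \<sqsubseteq> subst \<sigma> E" if "\<sigma> X \<sqsubseteq> subst \<sigma> E"
      using subst_subsumed_nonvar[OF flat Ib(4)] subsumed_trans[OF _ that] Sub[OF Ib(2)] by simp
    then show ?thesis unfolding Ib(1) lit_true_clause bex_Collect_image by auto
  next
    case (Ic X Y)
    then show ?thesis using Dissub by (fastforce simp: lit_true_clause)
  next
    case (III C\<^sub>1 C\<^sub>2 C\<^sub>3)
    then show ?thesis using subsumed_trans by (auto simp: lit_true_clause)
  next
    case (IV1 C X)
    \<comment> \<open>If no \<open>PNot C X D\<close> holds, every non-variable atom whose image
      subsumes \<open>\<sigma> X\<close> also has an image subsuming
      \<open>subst \<sigma> C\<close>.\<close>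
    show ?thesis using local_solution_nonvar[OF flat sol IV1(3), of "subst \<sigma> C"]
      unfolding IV1(1) lit_true_clause bex_simps(5) bex_Collect_image by auto
  next
    case (Vc X Y r)
    have "role_depth (\<sigma> Y) < role_depth (\<sigma> X)" if "\<sigma> X \<sqsubseteq> Exists r (\<sigma> Y)"
      using role_depth_subsumed[OF that] by simp
    then show ?thesis using Vc(1) by (simp add: lit_true_clause)
  \<comment> \<open>For group II, constants and existential restrictions are their own only
    top-level conjunct, so comparing them reduces to comparing constructors, names and
    fillers.\<close>
  qed (auto simp: lit_true_clause subsumed_Const_iff subsumed_Exists_iff)
qed

section \<open>From a satisfying valuation to a local solution\<close>

locale satisfied_Cl =
  fixes \<Gamma> :: "('v, 'c, 'r) problem" and \<tau> :: "('v, 'c, 'r) pvar \<Rightarrow> bool"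
  assumes flat: "flat_problem \<Gamma>"
    and sat: "K \<in> Cl \<Gamma> \<Longrightarrow> \<exists>l \<in> K. lit_true \<tau> l"
begin

lemma finite_problem: "finite \<Gamma>"
  using flat by (simp add: flat_problem_def)

lemma sat_clause: "P \<leadsto> Q \<in> Cl \<Gamma> \<Longrightarrow> (\<forall>p \<in> P. \<tau> p) \<longrightarrow> (\<exists>q \<in> Q. \<tau> q)"
  by (rule sat[of "P \<leadsto> Q", unfolded lit_true_clause])

definition S :: "'v \<Rightarrow> ('v, 'c, 'r) concept set" where
  "S X = {D \<in> At_nv \<Gamma>. \<tau> [Var X \<sqsubseteq>\<^sub>p D]}"

abbreviation \<sigma> :: "'v \<Rightarrow> ('v, 'c, 'r) concept" where
  "\<sigma> \<equiv> sigma \<Gamma> S"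

lemma trans_tau:
  assumes "C \<in> At \<Gamma>" "D \<in> At \<Gamma>" "E \<in> At \<Gamma>" "\<tau> [C \<sqsubseteq>\<^sub>p D]" "\<tau> [D \<sqsubseteq>\<^sub>p E]"
  shows "\<tau> [C \<sqsubseteq>\<^sub>p E]"
  using sat_clause[OF Cl.III[OF assms(1-3)]] assms(4,5) by auto

text \<open>A flat non-variable atom containing \<open>Y\<close> has the form
  \<open>Exists r (Var Y)\<close>, so \<open>Vc\<close> turns each dependency into a true
  \<open>[X >\<^sub>p Y]\<close>. \<open>Vb\<close> extends this to the transitive closure, and
  \<open>Va\<close> rules out cycles.\<close>

lemma acyclic_S: "acyclic_assignment \<Gamma> S"
proof -
  have edge: "X \<in> N_v \<Gamma> \<and> Y \<in> N_v \<Gamma> \<and> \<tau> [X >\<^sub>p Y]" if XY: "(X, Y) \<in> depends \<Gamma> S" for X Y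
  proof -
    obtain D where D: "X \<in> N_v \<Gamma>" "D \<in> At_nv \<Gamma>" "\<tau> [Var X \<sqsubseteq>\<^sub>p D]" "Y \<in> vars D"
      using XY by (auto simp: depends_def S_def)
    obtain r where r: "D = Exists r (Var Y)"
      using flat D(2)
    proof (cases rule: At_nv_cases)
      case (Exists r A)
      then show thesis using D(4) that by (auto elim: is_name_cases)
    qed (use D(4) in auto)
    have "D \<in> At \<Gamma>" using At_nv_At[OF D(2)] .
    then have "Y \<in> N_v \<Gamma>" using vars_At[of D \<Gamma>] D(4) by blast
    with \<open>D \<in> At \<Gamma>\<close> show ?thesis using sat_clause[OF Cl.Vc[OF D(1), of Y r]] D(1,3) r by simp
  qed
  have "X \<in> N_v \<Gamma> \<and> Y \<in> N_v \<Gamma> \<and> \<tau> [X >\<^sub>p Y]" if "(X, Y) \<in> (depends \<Gamma> S)\<^sup>+" for X Y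
    using that
  proof induction
    case (step Y Z)
    then show ?case using edge[OF step.hyps(2)] sat_clause[OF Cl.Vb[of X \<Gamma> Y Z]] by simp
  qed (rule edge)
  then have "(X, X) \<notin> (depends \<Gamma> S)\<^sup>+" for X
    using sat_clause[OF Cl.Va[of X]] by auto
  then show ?thesis by (auto simp: acyclic_assignment_def irrefl_def S_def)
qed

lemma sigma_subsumed: "X \<in> N_v \<Gamma> \<Longrightarrow> D \<in> S X \<Longrightarrow> \<sigma> X \<sqsubseteq> subst \<sigma> D"
  using subsumed_sigma_iff[OF finite_problem acyclic_S] subsumed_refl by blast

lemma tau_Const:
  assumes "A \<in> N_c \<Gamma>" "D \<in> At_nv \<Gamma>" "\<tau> [Const A \<sqsubseteq>\<^sub>p D]"
  shows "D = Const A"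
  using flat assms(2)
proof (cases rule: At_nv_cases)
  case (Const B)
  then show ?thesis using sat_clause[OF Cl.IIb[of A \<Gamma> B]] assms by auto
next
  case (Exists r B)
  then show ?thesis using sat_clause[OF Cl.IId1[of A \<Gamma> r B]] assms by auto
qed

lemma name_cases:
  assumes "C \<in> At \<Gamma>" "is_name C"
  obtains (Var) X where "C = Var X" "X \<in> N_v \<Gamma>" | (Const) A where "C = Const A" "A \<in> N_c \<Gamma>"
  using assms(2)
proof (cases rule: is_name_cases)
  case (Var X)
  then show thesis using vars_At[OF assms(1)] that by auto
next
  case (Const A)
  then show thesis using At_constants[OF assms(1)] that by auto
qed

text \<open>The conjuncts of \<open>\<sigma> Y\<close> are images of atoms \<open>E\<close> with
  \<open>[Var Y \<sqsubseteq>\<^sub>p E]\<close> true, and \<open>III\<close> yields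
  \<open>[C \<sqsubseteq>\<^sub>p E]\<close>. This reduces a variable on the right to non-variable
  atoms.\<close>

lemma tau_imp_subsumed_Var:
  assumes "C \<in> At \<Gamma>" "Y \<in> N_v \<Gamma>" "Var Y \<in> At \<Gamma>" "\<tau> [C \<sqsubseteq>\<^sub>p Var Y]"
    "\<And>D. D \<in> At_nv \<Gamma> \<Longrightarrow> \<tau> [C \<sqsubseteq>\<^sub>p D] \<Longrightarrow> subst \<sigma> C \<sqsubseteq> subst \<sigma> D"
  shows "subst \<sigma> C \<sqsubseteq> \<sigma> Y"
  unfolding subsumed_sigma_iff[OF finite_problem acyclic_S assms(2)]
  using assms trans_tau[OF assms(1,3)] At_nv_At by (auto simp: S_def)

text \<open>If \<open>C\<close> is a variable, a non-variable \<open>D\<close> is in its assigned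
  set by definition of \<open>S\<close>; if \<open>C\<close> is a constant, \<open>D\<close> must be
  the same constant.\<close>

lemma tau_imp_subsumed_name:
  assumes "C \<in> At \<Gamma>" "is_name C" "D \<in> At \<Gamma>" "\<tau> [C \<sqsubseteq>\<^sub>p D]"
  shows "subst \<sigma> C \<sqsubseteq> subst \<sigma> D"
proof -
  have nonvar: "subst \<sigma> C \<sqsubseteq> subst \<sigma> D" if "D \<in> At_nv \<Gamma>" "\<tau> [C \<sqsubseteq>\<^sub>p D]" for D
    using assms(1,2)
  proof (cases rule: name_cases)
    case (Var X)
    then show ?thesis using that sigma_subsumed by (simp add: S_def)
  next
    case (Const A)
    then show ?thesis using that tau_Const by fastforce
  qed
  from assms(3) show ?thesis
  proof (cases rule: At_cases)
    case (Var Y)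
    then show ?thesis using tau_imp_subsumed_Var[OF assms(1)] nonvar assms by simp
  next
    case Nonvar
    then show ?thesis using nonvar assms(4) by blast
  qed
qed

text \<open>For \<open>C\<close> an existential restriction, \<open>IId2\<close> and
  \<open>IIc\<close> force a non-variable right-hand side to use the same role. \<open>IIe1\<close>
  then passes to the fillers, which are names and thus already treated.\<close>

lemma tau_imp_subsumed:
  assumes "C \<in> At \<Gamma>" "D \<in> At \<Gamma>" "\<tau> [C \<sqsubseteq>\<^sub>p D]"
  shows "subst \<sigma> C \<sqsubseteq> subst \<sigma> D"
proof (cases "is_name C")
  case True
  then show ?thesis using tau_imp_subsumed_name assms by blast
next
  case False
  then have "C \<in> At_nv \<Gamma>" using assms(1) by (auto simp: At_nv_def)
  with flat False obtain r A where C: "C = Exists r A" "A \<in> At \<Gamma>" "is_name A" "Exists r A \<in> At_nv \<Gamma>"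
    by (auto elim: At_nv_cases)
  have *: "subst \<sigma> C \<sqsubseteq> subst \<sigma> D" if D: "D \<in> At_nv \<Gamma>" "\<tau> [C \<sqsubseteq>\<^sub>p D]" for D
    using flat D(1)
  proof (cases rule: At_nv_cases)
    case (Const B)
    then show ?thesis using sat_clause[OF Cl.IId2[of B \<Gamma> r A]] C D by auto
  next
    case (Exists s B)
    have [simp]: "s = r" using sat_clause[OF Cl.IIc[of r A \<Gamma> s B]] C D Exists by auto
    have "\<tau> [A \<sqsubseteq>\<^sub>p B]" using sat_clause[OF Cl.IIe1[of r A \<Gamma> B]] C D Exists by auto
    then show ?thesis
      using tau_imp_subsumed_name[OF C(2,3) Exists(2)] C Exists subsumed_Exists_mono by simp
  qed
  from assms(2) show ?thesis
  proof (cases rule: At_cases)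
    case (Var Y)
    then show ?thesis using tau_imp_subsumed_Var[OF assms(1)] * assms by simp
  next
    case Nonvar
    then show ?thesis using * assms(3) by blast
  qed
qed

text \<open>The cases build on one another: first both atoms non-variable, then arbitrary
  \<open>C\<close>, then a variable \<open>D\<close>. Only stripping a common role invokes the
  induction hypothesis.\<close>

lemma subsumed_imp_tau:
  "C \<in> At \<Gamma> \<Longrightarrow> D \<in> At \<Gamma> \<Longrightarrow> subst \<sigma> C \<sqsubseteq> subst \<sigma> D \<Longrightarrow> \<tau> [C \<sqsubseteq>\<^sub>p D]"
proof (induction "role_depth (subst \<sigma> D)" arbitrary: C D rule: less_induct)
  case less
  \<comment> \<open>A depth bound in place of \<open>E = D\<close> makes this available for the
    atoms \<open>E\<close> that \<open>IV1\<close> supplies when \<open>D\<close> is a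
    variable.\<close>
  have nonvar_nonvar: "\<tau> [C \<sqsubseteq>\<^sub>p E]"
    if C: "C \<in> At_nv \<Gamma>" and E: "E \<in> At_nv \<Gamma>" "subst \<sigma> C \<sqsubseteq> subst \<sigma> E"
      and depth: "role_depth (subst \<sigma> E) \<le> role_depth (subst \<sigma> D)" for C E
    using flat E(1)
  proof (cases rule: At_nv_cases)
    case (Const A)
    moreover have "C = E" using flat C
      by (cases rule: At_nv_cases) (use E Const in \<open>auto simp: subsumed_Const_iff\<close>)
    ultimately show ?thesis using sat_clause[OF Cl.IIa] by auto
  next
    case (Exists r B)
    obtain A where A: "C = Exists r A" "A \<in> At \<Gamma>" "subst \<sigma> A \<sqsubseteq> subst \<sigma> B"
      using flat C by (cases rule: At_nv_cases) (use E Exists in \<open>auto simp: subsumed_Exists_iff\<close>)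
    \<comment> \<open>The image of \<open>B\<close> is one level shallower than that of
      \<open>E\<close>, hence strictly shallower than that of \<open>D\<close>.\<close>
    then have "\<tau> [A \<sqsubseteq>\<^sub>p B]" using less.hyps[of B A] depth Exists by simp
    then show ?thesis using sat_clause[OF Cl.IIe2[of r A \<Gamma> B]] A C E Exists by auto
  qed
  have nonvar: "\<tau> [C \<sqsubseteq>\<^sub>p E]"
    if E: "E \<in> At_nv \<Gamma>" "subst \<sigma> C \<sqsubseteq> subst \<sigma> E"
      and depth: "role_depth (subst \<sigma> E) \<le> role_depth (subst \<sigma> D)" for E
    using less.prems(1)
  proof (cases rule: At_cases)
    case (Var X)
    have "top_atoms (\<sigma> X) = (\<Union>F \<in> S X. top_atoms (subst \<sigma> F))"
      by (rule top_atoms_sigma[OF finite_problem acyclic_S Var(2)])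
    \<comment> \<open>The conjunct of \<open>\<sigma> X\<close> that matches the image of
      \<open>E\<close> stems from some \<open>F\<close> in \<open>S X\<close>; \<open>III\<close>
      later joins \<open>[Var X \<sqsubseteq>\<^sub>p F]\<close> with
      \<open>[F \<sqsubseteq>\<^sub>p E]\<close>.\<close>
    with flat E(1) obtain F where F: "F \<in> S X" "subst \<sigma> F \<sqsubseteq> subst \<sigma> E"
      by (cases rule: At_nv_cases) (use E(2) Var in \<open>auto simp: subsumed_Const_iff subsumed_Exists_iff\<close>)
    then have "\<tau> [F \<sqsubseteq>\<^sub>p E]" using nonvar_nonvar E(1) depth by (simp add: S_def)
    then show ?thesis
      using trans_tau[OF less.prems(1)] F E(1) Var At_nv_At by (auto simp: S_def)
  next
    case Nonvar
    then show ?thesis using nonvar_nonvar that by blast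
  qed
  from less.prems(2) show ?case
  proof (cases rule: At_cases)
    case (Var Y)
    show ?thesis
    proof (rule ccontr)
      assume neg: "\<not> \<tau> [C \<sqsubseteq>\<^sub>p D]"
      \<comment> \<open>\<open>IV1\<close> supplies a separating atom \<open>E\<close>. By
        \<open>IV2\<close> it belongs to \<open>S Y\<close>, so its image subsumes that of
        \<open>C\<close>, which forces \<open>[C \<sqsubseteq>\<^sub>p E]\<close> against
        \<open>IV3\<close>.\<close>
      then obtain E where E: "E \<in> At_nv \<Gamma>" "\<tau> (PNot C Y E)"
        using sat_clause[OF Cl.IV1[OF less.prems(1) Var(2)]] Var by auto
      then have "E \<in> S Y"
        using sat_clause[OF Cl.IV2[OF less.prems(1) Var(2) E(1)]] by (auto simp: S_def)
      then have YE: "subst \<sigma> D \<sqsubseteq> subst \<sigma> E" using sigma_subsumed Var by simp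
      then have "\<tau> [C \<sqsubseteq>\<^sub>p E]"
        using nonvar[OF E(1)] less.prems(3) subsumed_trans role_depth_subsumed by blast
      then show False
        using sat_clause[OF Cl.IV3[OF less.prems(1) Var(2) E(1)]] E by auto
    qed
  next
    case Nonvar
    then show ?thesis using nonvar less.prems(3) by blast
  qed
qed

lemma subst_subsumed:
  "Sub C D \<in> \<Gamma> \<Longrightarrow> E \<in> top_atoms C \<Longrightarrow> F \<in> At \<Gamma> \<Longrightarrow> \<tau> [E \<sqsubseteq>\<^sub>p F] \<Longrightarrow> subst \<sigma> C \<sqsubseteq> subst \<sigma> F"
  by (rule subsumed_trans[OF subst_subsumed_top_atom tau_imp_subsumed[OF At_Sub_left]])

text \<open>Subsumptions follow from \<open>tau_imp_subsumed\<close>, with \<open>Ia\<close> or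
  \<open>Ib\<close> selecting a suitable conjunct on the left. Dissubsumptions need the converse
  \<open>subsumed_imp_tau\<close> together with \<open>Ic\<close>.\<close>

lemma local_solution: "local_solution \<Gamma> \<sigma>"
proof -
  have "subst \<sigma> C \<sqsubseteq> subst \<sigma> D" if CD: "Sub C D \<in> \<Gamma>" for C D
    using At_Sub_right[OF flat CD]
  proof (cases rule: At_cases)
    case (Var X)
    have "subst \<sigma> C \<sqsubseteq> subst \<sigma> E" if "E \<in> S X" for E
    proof -
      have E: "E \<in> At_nv \<Gamma>" "\<tau> [Var X \<sqsubseteq>\<^sub>p E]" using that by (simp_all add: S_def)
      then obtain F where "F \<in> top_atoms C" "\<tau> [F \<sqsubseteq>\<^sub>p E]"
        using sat_clause[OF Cl.Ib[OF CD[unfolded Var(1)] Var(2) E(1)]] by auto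
      then show ?thesis using subst_subsumed[OF CD] At_nv_At[OF E(1)] by blast
    qed
    then show ?thesis using subsumed_sigma_iff[OF finite_problem acyclic_S Var(2)] Var(1) by simp
  next
    case Nonvar
    then obtain F where "F \<in> top_atoms C" "\<tau> [F \<sqsubseteq>\<^sub>p D]"
      using sat_clause[OF Cl.Ia[OF CD]] by auto
    then show ?thesis using subst_subsumed[OF CD] At_Sub_right[OF flat CD] by blast
  qed
  moreover have "\<not> subst \<sigma> C \<sqsubseteq> subst \<sigma> D" if CD: "Dissub C D \<in> \<Gamma>" for C D
  proof -
    obtain X Y where XY: "C = Var X" "D = Var Y"
      using flat CD unfolding flat_problem_def by fastforce
    then have "\<not> \<tau> [C \<sqsubseteq>\<^sub>p D]" using sat_clause[OF Cl.Ic[of X Y \<Gamma>]] CD by simp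
    then show ?thesis using subsumed_imp_tau[of C D] At_Dissub[of X Y] CD XY by blast
  qed
  ultimately show ?thesis
    using sigma_names[OF finite_problem acyclic_S] acyclic_S by (auto simp: local_solution_def solution_def)
qed

end

theorem theorem6p7:
  fixes \<Gamma> :: "('v, 'c, 'r) problem"
  assumes "flat_problem \<Gamma>"
  shows "(\<exists>\<sigma>. local_solution \<Gamma> \<sigma>) \<longleftrightarrow> satisfiable (Cl \<Gamma>)"
proof
  assume "\<exists>\<sigma>. local_solution \<Gamma> \<sigma>"
  then show "satisfiable (Cl \<Gamma>)"
    using valuation_satisfies_Cl[OF assms] by (auto simp: satisfiable_def)
next
  assume "satisfiable (Cl \<Gamma>)"
  then obtain \<tau> where "satisfied_Cl \<Gamma> \<tau>"
    using assms by (auto simp: satisfiable_def satisfied_Cl_def)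
  then show "\<exists>\<sigma>. local_solution \<Gamma> \<sigma>"
    using satisfied_Cl.local_solution by blast
qed

end
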